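(* Let $\gamma\ge 1$ be a real number, let $1\le p<\infty$, and let \[ H_\gamma:=\{(z_1,z_2)\in\mathbb{C}^2: |z_1|<|z_2|^\gamma,\ |z_2|<1\}. \] Then \[ S_p(H_\gamma)=\left\{(\alpha_1,\alpha_2)\in\mathbb{Z}^2:\ \alpha_1\ge 0,\ \gamma\alpha_1+\alpha_2> -\frac{2}{p}-\frac{2\gamma}{p}\right\}. \] If $\gamma$ is rational, then the set of Threshold exponents of $H_\gamma$ is finite. If $\gamma$ is irrational, then every $p\in[1,\infty)$ is a Threshold exponent of $H_\gamma$, i.e. $\mathrm{Threshold}(H_\gamma)=[1,\infty)$.
   Context: For a domain $\Omega\subset\mathbb{C}^n$ and $1\le p<\infty$, $A^p(\Omega)$ denotes the space of holomorphic functions $f$ on $\Omega$ with $\int_\Omega|f|^p\,dV<\infty$, where $dV$ is Lebesgue measure. For $\alpha\in\mathbb{Z}^n$, $e_\alpha(z):=z_1^{\alpha_1}\cdots z_n^{\alpha_n}$ (a Laurent monomial if some exponents are negative), and $S_p(\Omega):=\{\alpha\in\mathbb{Z}^n: e_\alpha\in A^p(\Omega)\}$; in particular $e_\alpha$ is required to be holomorphic on $\Omega$. A number $p\in[1,\infty)$ is a Threshold exponent for $\Omega$ if for every $\varepsilon>0$ there exists $q\in(p-\varepsilon,p+\varepsilon)$ (with $q\ge1$, since $S_q$ is defined only for $q\in[1,\infty)$) such that $S_q(\Omega)\ne S_p(\Omega)$. $\mathrm{Threshold}(\Omega)$ denotes the set of Threshold exponents of $\Omega$. *)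

theory Defs
  imports "HOL-Analysis.Analysis"
begin

text \<open>Functions on a domain \<open>\<Omega> \<subseteq> \<complex>\<^sup>n\<close> are total functions on \<open>complex ^ 'n\<close> of which only the
  values on \<open>\<Omega>\<close> matter. All notions below are meant for open \<open>\<Omega>\<close>; holomorphic means that the
  Frechet derivative exists at every point of \<open>\<Omega>\<close> and is complex linear.\<close>

definition holomorphic_cn :: "(complex ^ 'n \<Rightarrow> complex) \<Rightarrow> (complex ^ 'n) set \<Rightarrow> bool" where
  "holomorphic_cn f \<Omega> \<longleftrightarrow>
     (\<forall>z\<in>\<Omega>. \<exists>D. (f has_derivative D) (at z) \<and> (\<forall>c h. D (c *s h) = c * D h))"

definition bergman_space :: "real \<Rightarrow> (complex ^ 'n) set \<Rightarrow> (complex ^ 'n \<Rightarrow> complex) set" where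
  "bergman_space p \<Omega> =
     {f. holomorphic_cn f \<Omega> \<and> (\<integral>\<^sup>+z\<in>\<Omega>. ennreal (norm (f z) powr p) \<partial>lborel) < \<infinity>}"

text \<open>With the convention \<open>0 powi k = 0\<close> for \<open>k < 0\<close>, a Laurent monomial is total. This does not
  make it holomorphic where it should be undefined: if \<open>\<alpha> $ i < 0\<close> and the open set \<open>\<Omega>\<close> meets
  \<open>z $ i = 0\<close>, then \<open>\<Omega>\<close> contains a point at which exactly the \<open>i\<close>-th coordinate vanishes, and the
  monomial is unbounded near that point.\<close>

definition laurent_monomial :: "int ^ 'n \<Rightarrow> complex ^ 'n \<Rightarrow> complex" where
  "laurent_monomial \<alpha> z = (\<Prod>i\<in>UNIV. (z $ i) powi (\<alpha> $ i))"

definition monomial_exponents :: "real \<Rightarrow> (complex ^ 'n) set \<Rightarrow> (int ^ 'n) set" where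
  "monomial_exponents p \<Omega> = {\<alpha>. laurent_monomial \<alpha> \<in> bergman_space p \<Omega>}"

definition threshold_exponent :: "(complex ^ 'n) set \<Rightarrow> real \<Rightarrow> bool" where
  "threshold_exponent \<Omega> p \<longleftrightarrow> 1 \<le> p \<and>
     (\<forall>\<epsilon>>0. \<exists>q. q \<in> {p - \<epsilon><..<p + \<epsilon>} \<and> 1 \<le> q \<and>
        monomial_exponents q \<Omega> \<noteq> monomial_exponents p \<Omega>)"

definition Threshold :: "(complex ^ 'n) set \<Rightarrow> real set" where
  "Threshold \<Omega> = {p. threshold_exponent \<Omega> p}"

definition hartogs_triangle :: "real \<Rightarrow> (complex ^ 2) set" where
  "hartogs_triangle \<gamma> = {z. norm (z $ 1) < norm (z $ 2) powr \<gamma> \<and> norm (z $ 2) < 1}"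

end

theory Submission imports Defs begin

text \<open>Integrating first over the slice \<open>|z\<^sub>1| < |z\<^sub>2|\<^sup>\<gamma>\<close> and using homogeneity, the \<open>p\<close>-th power
  of a monomial with \<open>\<alpha>\<^sub>1 \<ge> 0\<close> has integral \<open>C \<integral> |w|\<^sup>t\<close> over the unit disc, where
  \<open>0 < C < \<infinity>\<close> and \<open>t = p \<alpha>\<^sub>2 + \<gamma> (p \<alpha>\<^sub>1 + 2)\<close>; on dyadic annuli this is a geometric series that
  converges iff \<open>t > -2\<close>. So the exponents for \<open>p\<close> are cut out by
  \<open>\<gamma> \<alpha>\<^sub>1 + \<alpha>\<^sub>2 > - T / p\<close> with \<open>T = 2 (1 + \<gamma>)\<close>. For \<open>\<gamma> = a / b\<close> the left-hand side lies in
  \<open>(1 / b) \<int>\<close>, so the set can only jump when \<open>b T / p\<close> is one of the integers in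
  \<open>(0, b T]\<close>; for irrational \<open>\<gamma>\<close> the
  left-hand side takes a dense set of values, so it changes with every change of \<open>p\<close>.\<close>

section \<open>Lebesgue measure on pairs and homogeneous integrands\<close>

lemma measurable_vector2 [measurable]:
  "(\<lambda>(x, y). vector [x, y] :: 'a::euclidean_space ^ 2) \<in> borel_measurable (lborel \<Otimes>\<^sub>M lborel)"
proof -
  have "continuous_on UNIV (\<lambda>p::'a \<times> 'a. if i = 1 then fst p else snd p)" for i :: 2
    by (cases "i = 1") (simp_all add: continuous_on_fst continuous_on_snd)
  then have "continuous_on UNIV (\<lambda>p::'a \<times> 'a. \<chi> i::2. if i = 1 then fst p else snd p)"
    by (rule continuous_on_vec_lambda)
  moreover have "(\<lambda>(x, y). vector [x, y] :: 'a ^ 2) = (\<lambda>p. \<chi> i. if i = 1 then fst p else snd p)"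
    by (auto simp: fun_eq_iff vec_eq_iff forall_2)
  ultimately show ?thesis
    by (simp add: lborel_prod borel_measurable_continuous_onI)
qed

lemma Basis_vec2: "(Basis :: ('a::euclidean_space ^ 2) set) = axis 1 ` Basis \<union> axis 2 ` Basis"
  by (auto simp: Basis_vec_def UNIV_2)

text \<open>Lebesgue measure is determined by its values on boxes. A box of pairs is a product of
  two boxes, and the product of its side lengths splits over the two families of axis
  vectors.\<close>

lemma lborel_vec2:
  "(lborel :: ('a::euclidean_space ^ 2) measure) =
     distr (lborel \<Otimes>\<^sub>M lborel) borel (\<lambda>(x, y). vector [x, y])"
proof (rule lborel_eqI)
  have prod_Basis: "(\<Prod>b\<in>Basis. f b) = (\<Prod>b\<in>Basis. f (axis 1 b)) * (\<Prod>b\<in>Basis. f (axis 2 b))"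
    for f :: "'a ^ 2 \<Rightarrow> real"
  proof -
    have "axis 1 ` Basis \<inter> axis 2 ` (Basis :: 'a set) = ({} :: ('a ^ 2) set)"
      by (auto simp: axis_eq_axis)
    moreover have "inj_on (axis i :: 'a \<Rightarrow> 'a ^ 2) Basis" for i
      by (auto simp: inj_on_def axis_eq_axis)
    ultimately show ?thesis
      unfolding Basis_vec2 by (subst prod.union_disjoint) (auto simp: prod.reindex)
  qed
  fix l u :: "'a ^ 2"
  assume le: "\<And>b. b \<in> Basis \<Longrightarrow> l \<bullet> b \<le> u \<bullet> b"
  have le': "l $ i \<bullet> b \<le> u $ i \<bullet> b" if "b \<in> Basis" for i b
    using le[of "axis i b"] that by (simp add: inner_axis)
  have "(\<lambda>(x, y). vector [x, y]) -` box l u \<inter> space (lborel \<Otimes>\<^sub>M lborel) =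
      box (l $ 1) (u $ 1) \<times> box (l $ 2) (u $ 2)"
    by (auto simp: mem_box Basis_vec2 ball_Un inner_axis space_pair_measure)
  then have "emeasure (distr (lborel \<Otimes>\<^sub>M lborel) borel (\<lambda>(x, y). vector [x, y])) (box l u) =
      emeasure lborel (box (l $ 1) (u $ 1)) * emeasure lborel (box (l $ 2) (u $ 2))"
    by (simp add: emeasure_distr lborel.emeasure_pair_measure_Times)
  also have "\<dots> = (\<Prod>b\<in>Basis. (u - l) \<bullet> b)"
    using le' by (simp add: emeasure_lborel_box prod_Basis inner_axis ennreal_mult' prod_nonneg
        inner_diff_left)
  finally show "emeasure (distr (lborel \<Otimes>\<^sub>M lborel) borel (\<lambda>(x, y). vector [x, y])) (box l u) =
      (\<Prod>b\<in>Basis. (u - l) \<bullet> b)" .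
qed simp

text \<open>Tonelli with the second coordinate outermost: the Hartogs triangle has discs as slices
  once \<open>z $ 2\<close> is fixed.\<close>

lemma nn_integral_lborel_vec2:
  fixes f :: "'a::euclidean_space ^ 2 \<Rightarrow> ennreal"
  assumes [measurable]: "f \<in> borel_measurable borel"
  shows "(\<integral>\<^sup>+z. f z \<partial>lborel) = (\<integral>\<^sup>+y. \<integral>\<^sup>+x. f (vector [x, y]) \<partial>lborel \<partial>lborel)"
proof -
  have m: "(\<lambda>p. f (case p of (x, y) \<Rightarrow> vector [x, y])) \<in> borel_measurable (lborel \<Otimes>\<^sub>M lborel)"
    by measurable
  show ?thesis
    apply (subst lborel_vec2)
    apply (subst nn_integral_distr)
      apply (rule measurable_vector2)
     apply simp
    using lborel_pair.nn_integral_snd[OF m] by simp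
qed

section \<open>Scaling and positivity of integrals, and powers of the norm on the unit disc\<close>

lemma nn_integral_lborel_scaleR:
  fixes f :: "'a::euclidean_space \<Rightarrow> ennreal"
  assumes [measurable]: "f \<in> borel_measurable borel" and "0 < r"
  shows "(\<integral>\<^sup>+x. f x \<partial>lborel) = ennreal (r ^ DIM('a)) * (\<integral>\<^sup>+x. f (r *\<^sub>R x) \<partial>lborel)"
proof -
  have "(\<integral>\<^sup>+x. f x \<partial>lborel) =
    (\<integral>\<^sup>+x. f x \<partial>density (distr lborel borel (\<lambda>x. 0 + r *\<^sub>R x)) (\<lambda>_. ennreal (\<bar>r\<bar> ^ DIM('a))))"
    using lborel_affine[of r "0::'a"] \<open>0 < r\<close> by auto
  also have "\<dots> = ennreal (r ^ DIM('a)) * (\<integral>\<^sup>+x. f (r *\<^sub>R x) \<partial>lborel)"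
    using \<open>0 < r\<close> by (simp add: nn_integral_density nn_integral_distr nn_integral_cmult)
  finally show ?thesis .
qed

text \<open>Change of variables by dilation. The summand 2 in the exponent is the real dimension of
  the plane, from the Jacobian \<open>r ^ 2\<close>.\<close>

lemma set_nn_integral_homogeneous:
  fixes f :: "complex \<Rightarrow> real" and g :: "real \<Rightarrow> real"
  assumes [measurable]: "f \<in> borel_measurable borel" "A \<in> sets borel"
    and f: "\<And>x. f (r *\<^sub>R x) = r powr s * f x" and r: "0 < r"
  shows "(\<integral>\<^sup>+x\<in>(\<lambda>x. r *\<^sub>R x) ` A. ennreal (f x) \<partial>lborel) =
    ennreal (r powr (s + 2)) * (\<integral>\<^sup>+x\<in>A. ennreal (f x) \<partial>lborel)"
proof -
  have im: "(\<lambda>x. r *\<^sub>R x) ` A = (\<lambda>x. inverse r *\<^sub>R x) -` A"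
    using r by (force simp: image_iff)
  have [measurable]: "(\<lambda>x. r *\<^sub>R x) ` A \<in> sets borel"
    using measurable_sets[OF _ assms(2), of "\<lambda>x. inverse r *\<^sub>R x" borel] unfolding im by simp
  have "(\<integral>\<^sup>+x\<in>(\<lambda>x. r *\<^sub>R x) ` A. ennreal (f x) \<partial>lborel) =
      ennreal (r ^ 2) * (\<integral>\<^sup>+x. ennreal (f (r *\<^sub>R x)) * indicator ((\<lambda>x. r *\<^sub>R x) ` A) (r *\<^sub>R x) \<partial>lborel)"
    by (subst nn_integral_lborel_scaleR[OF _ r]) simp_all
  also have "(\<lambda>x. ennreal (f (r *\<^sub>R x)) * indicator ((\<lambda>x. r *\<^sub>R x) ` A) (r *\<^sub>R x)) =
      (\<lambda>x. ennreal (r powr s) * (ennreal (f x) * indicator A x))"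
    using r by (auto simp: f fun_eq_iff ennreal_mult' indicator_def)
  also have "(\<integral>\<^sup>+x. ennreal (r powr s) * (ennreal (f x) * indicator A x) \<partial>lborel) =
      ennreal (r powr s) * (\<integral>\<^sup>+x\<in>A. ennreal (f x) \<partial>lborel)"
    by (rule nn_integral_cmult) measurable
  also have "ennreal (r ^ 2) * \<dots> = ennreal (r ^ 2 * r powr s) * (\<integral>\<^sup>+x\<in>A. ennreal (f x) \<partial>lborel)"
    by (simp only: ennreal_mult' zero_le_power2 mult.assoc)
  also have "r ^ 2 * r powr s = r powr (s + 2)"
    using r by (simp add: powr_add)
  finally show ?thesis .
qed

lemma set_nn_integral_pos:
  fixes f :: "'a::euclidean_space \<Rightarrow> ennreal"
  assumes [measurable]: "f \<in> borel_measurable borel" "A \<in> sets borel"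
    and "0 < r" "ball a r \<subseteq> A" "\<And>x. x \<in> ball a r \<Longrightarrow> 0 < f x"
  shows "0 < (\<integral>\<^sup>+x\<in>A. f x \<partial>lborel)"
proof (rule ccontr)
  assume "\<not> ?thesis"
  then have "emeasure lborel {x. f x * indicator A x \<noteq> 0} = 0"
    by (simp add: nn_integral_0_iff)
  moreover have "ball a r \<subseteq> {x. f x * indicator A x \<noteq> 0}"
    using assms by (force simp: indicator_def)
  moreover have "{x. f x * indicator A x \<noteq> 0} \<in> sets lborel"
    by measurable
  ultimately have "emeasure lborel (ball a r) = 0"
    using emeasure_mono by (metis le_zero_eq)
  then show False
    using content_ball_pos[OF \<open>0 < r\<close>, of a] by (simp add: measure_def)
qed

text \<open>The annuli \<open>A k\<close> are dilates of \<open>A 0\<close> by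
  \<open>(1/2) ^ k\<close>, so homogeneity makes their integrals a geometric sequence with ratio
  \<open>c\<close>. Finiteness is thus \<open>c < 1\<close>, that is,
  \<open>t + 2 > 0\<close>.\<close>

lemma nn_integral_norm_powr_unit_disc_finite_iff:
  "(\<integral>\<^sup>+w\<in>ball (0::complex) 1. ennreal (norm w powr t) \<partial>lborel) < \<infinity> \<longleftrightarrow> -2 < t"
proof -
  \<comment> \<open>Closed on the inside and open on the outside, so that consecutive annuli neither
    overlap nor leave gaps.\<close>
  define A where "A = (\<lambda>k. {w::complex. (1/2) ^ Suc k \<le> norm w \<and> norm w < (1/2) ^ k})"
  define C where "C = (\<integral>\<^sup>+w\<in>A 0. ennreal (norm w powr t) \<partial>lborel)"
  define c :: real where "c = (1/2) powr (t + 2)"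
  have c_nonneg: "0 \<le> c ^ k" for k
    by (simp add: c_def)
  have A_meas [measurable]: "A k \<in> sets borel" for k
    by (simp add: A_def)
  have A_scale: "A k = (\<lambda>w. (1/2) ^ k *\<^sub>R w) ` A 0" for k
  proof -
    have "w \<in> A k \<longleftrightarrow> 2 ^ k *\<^sub>R w \<in> A 0" for w
      by (simp add: A_def field_simps)
    moreover have "w = (1/2) ^ k *\<^sub>R (2 ^ k *\<^sub>R w)" "2 ^ k *\<^sub>R ((1/2) ^ k *\<^sub>R w) = w" for w :: complex
      by (simp_all add: power_one_over)
    ultimately show ?thesis
      by (metis (no_types, lifting) image_iff set_eqI)
  qed
  have A_integral: "(\<integral>\<^sup>+w\<in>A k. ennreal (norm w powr t) \<partial>lborel) = ennreal (c ^ k) * C" for k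
  proof -
    have "(\<integral>\<^sup>+w\<in>A k. ennreal (norm w powr t) \<partial>lborel) = ennreal (((1/2) ^ k) powr (t + 2)) * C"
      unfolding A_scale[of k] C_def
      by (rule set_nn_integral_homogeneous) (simp_all add: powr_mult)
    also have "((1/2) ^ k) powr (t + 2) = c ^ k"
      by (simp add: c_def powr_power powr_realpow[symmetric] powr_powr mult.commute)
    finally show ?thesis .
  qed
  have A_disjoint: "disjoint_family A"
  proof -
    have "A j \<inter> A k = {}" if "j < k" for j k
    proof -
      have "(1/2::real) ^ k \<le> (1/2) ^ Suc j"
        using that by (intro power_decreasing) auto
      then have False if "w \<in> A j" "w \<in> A k" for w
        using that unfolding A_def mem_Collect_eq by linarith
      then show ?thesis
        by blast
    qed
    then show ?thesis
      unfolding disjoint_family_on_def by (metis inf_commute linorder_neqE_nat)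
  qed
  have A_union: "(\<Union>k. A k) = ball 0 1 - {0}"
  proof (intro equalityI subsetI)
    fix w :: complex
    assume "w \<in> (\<Union>k. A k)"
    then obtain k where k: "(1/2) ^ Suc k \<le> norm w" "norm w < (1/2) ^ k"
      by (auto simp: A_def)
    moreover have "(1/2::real) ^ k \<le> 1" "0 < (1/2::real) ^ Suc k"
      by (auto intro: power_le_one)
    ultimately have "0 < norm w" "norm w < 1"
      by linarith+
    then show "w \<in> ball 0 1 - {0}"
      by simp
  next
    fix w :: complex
    assume w: "w \<in> ball 0 1 - {0}"
    then obtain n where "(1/2) ^ n < norm w"
      using real_arch_pow_inv[of "norm w" "1/2"] by auto
    \<comment> \<open>The least exponent whose power of 1/2 is at most \<open>norm w\<close> is not
      0, because \<open>norm w < 1\<close>; \<open>k\<close> is its predecessor.\<close>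
    then obtain k where "\<not> (1/2) ^ k \<le> norm w" "(1/2) ^ Suc k \<le> norm w"
      using w dec_induct ex_least_nat_less[of "\<lambda>n. (1/2) ^ n \<le> norm w" n] by force
    then show "w \<in> (\<Union>k. A k)"
      by (auto simp: A_def)
  qed
  have "0 < C"
    unfolding C_def
  \<comment> \<open>Norms on this ball lie between 5/8 and 7/8, well inside the range from 1/2 to 1
    that defines \<open>A 0\<close>.\<close>
  proof (rule set_nn_integral_pos[of _ _ "1/8" "3/4"])
    have norm: "\<bar>norm w - 3/4\<bar> < 1/8" if "w \<in> ball (3/4) (1/8)" for w :: complex
      using that norm_triangle_ineq3[of w "3/4"] by (simp add: dist_norm norm_minus_commute)
    show "ball (3/4) (1/8) \<subseteq> A 0"
    proof
      fix w :: complex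
      assume "w \<in> ball (3/4) (1/8)"
      from norm[OF this] show "w \<in> A 0"
        unfolding A_def mem_Collect_eq by simp argo
    qed
    show "0 < ennreal (norm w powr t)" if "w \<in> ball (3/4) (1/8)" for w :: complex
      using norm[OF that] by auto
  qed simp_all
  have "C < \<infinity>"
  proof -
    \<comment> \<open>On \<open>A 0\<close> the norm lies between 1/2 and 1, so the power is at most
      1 for nonnegative \<open>t\<close> and at most its value at 1/2 for negative
      \<open>t\<close>.\<close>
    have "C \<le> (\<integral>\<^sup>+w. ennreal (max 1 ((1/2) powr t)) * indicator (ball (0::complex) 1) w \<partial>lborel)"
      unfolding C_def
    proof (intro nn_integral_mono)
      fix w :: complex
      have "norm w powr t \<le> max 1 ((1/2) powr t)" if "w \<in> A 0"
        using that powr_le1[of t "norm w"] powr_mono2'[of "t" "1/2" "norm w"]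
        by (cases "0 \<le> t") (auto simp: A_def)
      moreover have "w \<in> ball 0 1" if "w \<in> A 0"
        using that by (simp add: A_def)
      ultimately show "ennreal (norm w powr t) * indicator (A 0) w \<le>
          ennreal (max 1 ((1/2) powr t)) * indicator (ball 0 1) w"
        by (auto simp: indicator_def intro!: ennreal_leI)
    qed
    also have "\<dots> < \<infinity>"
      using emeasure_lborel_ball_finite[of "0::complex" 1]
      by (simp add: nn_integral_cmult_indicator ennreal_mult_less_top)
    finally show ?thesis .
  qed
  \<comment> \<open>With the integrand as a density, summing over the annuli is countable additivity
    of \<open>M\<close>.\<close>
  define M where "M = density (lborel :: complex measure) (\<lambda>w. ennreal (norm w powr t))"
  have M: "emeasure M B = (\<integral>\<^sup>+w\<in>B. ennreal (norm w powr t) \<partial>lborel)" if "B \<in> sets borel" for B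
    unfolding M_def using that by (intro emeasure_density) auto
  \<comment> \<open>The annuli miss only the origin, where the integrand vanishes by the convention
    \<open>0 powr t = 0\<close>.\<close>
  have "(\<integral>\<^sup>+w\<in>ball (0::complex) 1. ennreal (norm w powr t) \<partial>lborel) = emeasure M (\<Union>k. A k)"
    by (subst M) (auto simp: A_union indicator_def intro!: nn_integral_cong)
  also have "\<dots> = (\<Sum>k. emeasure M (A k))"
    using A_disjoint by (intro suminf_emeasure[symmetric]) (auto simp: M_def)
  also have "\<dots> = (\<Sum>k. ennreal (c ^ k)) * C"
    by (simp add: M A_integral)
  also have "\<dots> < \<infinity> \<longleftrightarrow> (\<Sum>k. ennreal (c ^ k)) < \<infinity>"
    using \<open>0 < C\<close> \<open>C < \<infinity>\<close> by (auto simp: ennreal_mult_less_top)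
  also have "\<dots> \<longleftrightarrow> summable (\<lambda>k. c ^ k)"
  proof
    show "summable (\<lambda>k. c ^ k)" if "(\<Sum>k. ennreal (c ^ k)) < \<infinity>"
      using c_nonneg that by (intro summable_suminf_not_top) (auto simp only: infinity_ennreal_def)
    show "(\<Sum>k. ennreal (c ^ k)) < \<infinity>" if "summable (\<lambda>k. c ^ k)"
      using suminf_ennreal2[OF c_nonneg that] by simp
  qed
  also have "\<dots> \<longleftrightarrow> c < 1"
    by (simp add: summable_geometric_iff c_def)
  also have "\<dots> \<longleftrightarrow> -2 < t"
  proof -
    have "c = 2 powr (- (t + 2))"
      by (simp only: c_def powr_minus powr_divide powr_one_eq_one inverse_eq_divide)
    then show ?thesis
      using powr_less_cancel_iff[of 2 "- (t + 2)" 0] by auto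
  qed
  finally show ?thesis .
qed

section \<open>Integer powers on discs in the plane\<close>

lemma borel_measurable_power_int [measurable (raw)]:
  fixes f :: "'a \<Rightarrow> complex"
  assumes [measurable]: "f \<in> borel_measurable M"
  shows "(\<lambda>x. f x powi n) \<in> borel_measurable M"
  by (cases "n \<ge> 0") (auto simp: power_int_def)

lemma norm_powi_powr: "norm (w powi n) powr p = norm w powr (of_int n * p)" if "w \<noteq> 0" for w :: complex
  using that by (simp add: norm_power_int powr_real_of_int'[symmetric] powr_powr)

text \<open>\<open>C\<close> is the integral over the unit disc, finite because the integrand is at
  most 1 there when \<open>n\<close> is nonnegative. Homogeneity then yields every radius with the
  same \<open>C\<close>, so slice integrals become pure powers of the slice radius.\<close>

lemma nn_integral_powi_ball:
  assumes "0 \<le> n" "0 \<le> p"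
  obtains C where "0 < C" "C < \<infinity>"
    "\<And>r. 0 < r \<Longrightarrow> (\<integral>\<^sup>+z\<in>ball (0::complex) r. ennreal (norm (z powi n) powr p) \<partial>lborel) =
       ennreal (r powr (of_int n * p + 2)) * C"
proof
  let ?C = "\<integral>\<^sup>+z\<in>ball (0::complex) 1. ennreal (norm (z powi n) powr p) \<partial>lborel"
  show "0 < ?C"
  proof (rule set_nn_integral_pos[of _ _ "1/4" "1/2"])
    show "ball (1/2) (1/4) \<subseteq> ball (0::complex) 1"
      by (simp add: ball_subset_ball_iff dist_norm)
    show "0 < ennreal (norm (z powi n) powr p)" if "z \<in> ball (1/2) (1/4)" for z :: complex
      using that by (auto simp: dist_norm)
  qed simp_all
  have "?C \<le> (\<integral>\<^sup>+z. indicator (ball (0::complex) 1) z \<partial>lborel)"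
  proof (intro nn_integral_mono)
    fix z :: complex
    have "norm (z powi n) powr p \<le> 1" if "z \<in> ball 0 1"
      using that assms by (intro powr_le1) (auto simp: power_int_def norm_power intro!: power_le_one)
    then show "ennreal (norm (z powi n) powr p) * indicator (ball 0 1) z \<le> indicator (ball 0 1) z"
      by (auto simp: indicator_def)
  qed
  also have "\<dots> < \<infinity>"
    using emeasure_lborel_ball_finite[of "0::complex" 1] by (simp add: less_top[symmetric])
  finally show "?C < \<infinity>" .
  show "(\<integral>\<^sup>+z\<in>ball (0::complex) r. ennreal (norm (z powi n) powr p) \<partial>lborel) =
      ennreal (r powr (of_int n * p + 2)) * ?C" if r: "0 < r" for r
  proof -
    have "ball (0::complex) r = (\<lambda>z. r *\<^sub>R z) ` ball 0 1"
      using r by (simp add: ball_scale)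
    moreover have "norm ((r *\<^sub>R z) powi n) powr p = r powr (of_int n * p) * norm (z powi n) powr p"
      for z :: complex
      using r by (simp add: scaleR_conv_of_real power_int_mult_distrib norm_mult powr_mult
          norm_power_int powr_real_of_int'[symmetric] powr_powr)
    ultimately show ?thesis
      using r by (simp add: set_nn_integral_homogeneous)
  qed
qed

section \<open>Integrability and holomorphy of Laurent monomials\<close>

text \<open>Each factor is complex differentiable in its own variable, and the product rule writes
  the derivative as a complex linear combination of the coordinates of \<open>h\<close>.\<close>

lemma holomorphic_laurent_monomial:
  fixes \<alpha> :: "int ^ 'n"
  assumes "\<And>z i. z \<in> \<Omega> \<Longrightarrow> \<alpha> $ i < 0 \<Longrightarrow> z $ i \<noteq> 0"
  shows "holomorphic_cn (laurent_monomial \<alpha>) \<Omega>"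
  unfolding holomorphic_cn_def
proof
  fix z assume z: "z \<in> \<Omega>"
  have "\<exists>c. ((\<lambda>x. x $ i powi \<alpha> $ i) has_derivative (\<lambda>h. c * h $ i)) (at z)" for i
  proof -
    have "\<exists>c. ((\<lambda>w::complex. w powi \<alpha> $ i) has_field_derivative c) (at (z $ i))"
    proof (cases "\<alpha> $ i < 0")
      case True
      then show ?thesis
        using assms[OF z True] DERIV_power_int[OF DERIV_ident] by blast
    next
      case False
      \<comment> \<open>An ordinary power is differentiable at 0 as well, so \<open>z $ i\<close>
        may vanish here.\<close>
      then have "(\<lambda>w::complex. w powi \<alpha> $ i) = (\<lambda>w. w ^ nat (\<alpha> $ i))"
        by (auto simp: power_int_def)
      then show ?thesis
        using DERIV_pow[of "nat (\<alpha> $ i)"] DERIV_power[OF DERIV_ident] by auto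
    qed
    then obtain c where "((\<lambda>w::complex. w powi \<alpha> $ i) has_derivative (*) c) (at (z $ i))"
      by (auto simp: has_field_derivative_def)
    then show ?thesis
      using has_derivative_compose[of "\<lambda>x. x $ i" "\<lambda>h. h $ i" z UNIV "\<lambda>w. w powi \<alpha> $ i" "(*) c"]
        bounded_linear_imp_has_derivative[OF bounded_linear_vec_nth[of i], of "at z"] by auto
  qed
  then obtain c where "\<And>i. ((\<lambda>x. x $ i powi \<alpha> $ i) has_derivative (\<lambda>h. c i * h $ i)) (at z)"
    by metis
  then have "(laurent_monomial \<alpha> has_derivative
      (\<lambda>h. \<Sum>i\<in>UNIV. c i * h $ i * (\<Prod>j\<in>UNIV - {i}. z $ j powi \<alpha> $ j))) (at z)"
    unfolding laurent_monomial_def by (intro has_derivative_prod)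
  then show "\<exists>D. (laurent_monomial \<alpha> has_derivative D) (at z) \<and> (\<forall>c h. D (c *s h) = c * D h)"
    by (intro exI conjI) (auto simp: sum_distrib_left ac_simps)
qed

lemma laurent_monomial_2:
  "laurent_monomial \<alpha> z = (z $ 1) powi (\<alpha> $ 1) * (z $ 2) powi (\<alpha> $ 2)" for z :: "complex ^ 2"
  by (simp add: laurent_monomial_def UNIV_2)

text \<open>Even continuity at \<open>z\<close> fails. Along the first coordinate line the value at
  0 is 0 by the convention for \<open>powi\<close>, while nearby values have norm at least that of
  the nonzero factor \<open>c\<close>.\<close>

lemma not_holomorphic_laurent_monomial:
  fixes \<alpha> :: "int ^ 2"
  assumes "\<alpha> $ 1 < 0" "z \<in> \<Omega>" "z $ 1 = 0" "z $ 2 \<noteq> 0"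
  shows "\<not> holomorphic_cn (laurent_monomial \<alpha>) \<Omega>"
proof
  define c where "c = (z $ 2) powi (\<alpha> $ 2)"
  assume "holomorphic_cn (laurent_monomial \<alpha>) \<Omega>"
  then have *: "isCont (laurent_monomial \<alpha>) z"
    using \<open>z \<in> \<Omega>\<close> has_derivative_continuous unfolding holomorphic_cn_def by blast
  have "isCont (\<lambda>x. \<chi> i::2. if i = 1 then x else z $ 2) (0::complex)"
    unfolding isCont_def by (intro tendsto_vec_lambda) auto
  moreover have "(\<chi> i::2. if i = 1 then 0 else z $ 2) = z"
    using assms by (auto simp: vec_eq_iff forall_2)
  ultimately have "isCont (\<lambda>x. laurent_monomial \<alpha> (\<chi> i. if i = 1 then x else z $ 2)) 0"
    using * isCont_o2[where g = "laurent_monomial \<alpha>"] by metis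
  then have "isCont (\<lambda>x. x powi (\<alpha> $ 1) * c) 0"
    by (simp add: laurent_monomial_2 c_def)
  then have "((\<lambda>x. x powi (\<alpha> $ 1) * c) \<longlongrightarrow> 0) (at 0)"
    using assms(1) by (simp add: isCont_def)
  moreover have "norm c > 0"
    using assms by (simp add: c_def)
  ultimately have "\<forall>\<^sub>F x in at 0. norm (x powi (\<alpha> $ 1) * c) < norm c"
    by (simp add: tendsto_iff)
  moreover have "\<forall>\<^sub>F x::complex in at 0. x \<in> ball 0 1 - {0}"
    by (intro eventually_at_in_open) auto
  \<comment> \<open>This is absurd because 0 is not isolated in the complex plane.\<close>
  ultimately have "\<forall>\<^sub>F x::complex in at 0. False"
  proof eventually_elim
    case (elim x)
    then have "1 \<le> norm x powi (\<alpha> $ 1)"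
      using assms(1) by (auto simp: power_int_def one_le_inverse_iff power_inverse intro!: power_le_one)
    then have "1 * norm c \<le> norm x powi (\<alpha> $ 1) * norm c"
      by (intro mult_right_mono) auto
    then show ?case
      using elim by (simp add: norm_mult norm_power_int)
  qed
  then show False
    by simp
qed

lemma nn_integral_laurent_monomial_hartogs_triangle:
  assumes "0 \<le> \<alpha> $ 1" "1 \<le> p"
  shows "(\<integral>\<^sup>+z\<in>hartogs_triangle \<gamma>. ennreal (norm (laurent_monomial \<alpha> z) powr p) \<partial>lborel) < \<infinity> \<longleftrightarrow>
    \<gamma> * of_int (\<alpha> $ 1) + of_int (\<alpha> $ 2) > - (2 * (1 + \<gamma>) / p)"
proof -
  \<comment> \<open>The exponent of \<open>norm y\<close> after integrating out the first
    coordinate: the second factor gives \<open>\<alpha> $ 2\<close> times \<open>p\<close>, and the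
    disc of radius \<open>norm y powr \<gamma>\<close> gives the rest.\<close>
  define t where "t = of_int (\<alpha> $ 2) * p + \<gamma> * (of_int (\<alpha> $ 1) * p + 2)"
  obtain C where C: "0 < C" "C < \<infinity>"
    "\<And>r. 0 < r \<Longrightarrow> (\<integral>\<^sup>+z\<in>ball (0::complex) r. ennreal (norm (z powi (\<alpha> $ 1)) powr p) \<partial>lborel) =
       ennreal (r powr (of_int (\<alpha> $ 1) * p + 2)) * C"
    using nn_integral_powi_ball[of "\<alpha> $ 1" p] assms by auto
  have [measurable]: "(\<lambda>z::complex ^ 2. z $ i) \<in> borel_measurable borel" for i
    by (intro borel_measurable_continuous_onI continuous_intros)
  have [measurable]: "hartogs_triangle \<gamma> \<in> sets borel"
    unfolding hartogs_triangle_def by measurable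
  have [measurable]: "laurent_monomial \<alpha> \<in> borel_measurable borel"
    unfolding laurent_monomial_2 by measurable
  have [measurable]: "ball (0::complex) r \<in> sets borel" for r
    by simp
  \<comment> \<open>Also valid at \<open>y = 0\<close>: the slice is empty there since
    \<open>0 powr \<gamma> = 0\<close>, and the right-hand side vanishes since
    \<open>0 powr t = 0\<close>.\<close>
  have slice: "(\<integral>\<^sup>+x. ennreal (norm (laurent_monomial \<alpha> (vector [x, y])) powr p) *
        indicator (hartogs_triangle \<gamma>) (vector [x, y]) \<partial>lborel) =
      ennreal (norm y powr t) * indicator (ball 0 1) y * C" for y
  proof (cases "y \<noteq> 0 \<and> norm y < 1")
    case True
    have "(\<integral>\<^sup>+x. ennreal (norm (laurent_monomial \<alpha> (vector [x, y])) powr p) *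
        indicator (hartogs_triangle \<gamma>) (vector [x, y]) \<partial>lborel) =
      (\<integral>\<^sup>+x. ennreal (norm (y powi (\<alpha> $ 2)) powr p) *
        (ennreal (norm (x powi (\<alpha> $ 1)) powr p) * indicator (ball (0::complex) (norm y powr \<gamma>)) x) \<partial>lborel)"
      using True
      by (intro nn_integral_cong)
         (auto simp: hartogs_triangle_def laurent_monomial_2 indicator_def norm_mult powr_mult ennreal_mult' mult.commute)
    also have "\<dots> = ennreal (norm (y powi (\<alpha> $ 2)) powr p) *
        (\<integral>\<^sup>+x\<in>ball (0::complex) (norm y powr \<gamma>). ennreal (norm (x powi (\<alpha> $ 1)) powr p) \<partial>lborel)"
      by (rule nn_integral_cmult) measurable
    also have "(\<integral>\<^sup>+x\<in>ball (0::complex) (norm y powr \<gamma>). ennreal (norm (x powi (\<alpha> $ 1)) powr p) \<partial>lborel) =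
        ennreal ((norm y powr \<gamma>) powr (of_int (\<alpha> $ 1) * p + 2)) * C"
      using True by (intro C(3)) simp
    also have "ennreal (norm (y powi (\<alpha> $ 2)) powr p) * \<dots> = ennreal (norm y powr t) * C"
      by (simp only: norm_powi_powr[OF conjunct1[OF True]] powr_powr t_def
          powr_add[of _ "of_int (\<alpha> $ 2) * p"] mult.assoc ennreal_mult' powr_ge_zero)
    finally show ?thesis
      using True by simp
  next
    case False
    then have "vector [x, y] \<notin> hartogs_triangle \<gamma>" for x
      by (auto simp: hartogs_triangle_def)
    then show ?thesis
      using False by (auto simp: indicator_def)
  qed
  have "(\<integral>\<^sup>+z\<in>hartogs_triangle \<gamma>. ennreal (norm (laurent_monomial \<alpha> z) powr p) \<partial>lborel) =
      (\<integral>\<^sup>+y\<in>ball (0::complex) 1. ennreal (norm y powr t) \<partial>lborel) * C"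
    by (subst nn_integral_lborel_vec2) (simp_all add: slice nn_integral_multc)
  also have "\<dots> < \<infinity> \<longleftrightarrow> -2 < t"
    using C by (auto simp: ennreal_mult_less_top nn_integral_norm_powr_unit_disc_finite_iff[symmetric])
  also have "\<dots> \<longleftrightarrow> \<gamma> * of_int (\<alpha> $ 1) + of_int (\<alpha> $ 2) > - (2 * (1 + \<gamma>) / p)"
    using assms by (simp add: t_def field_simps)
  finally show ?thesis .
qed

text \<open>Holomorphy decides the sign of \<open>\<alpha> $ 1\<close>: the domain contains points
  with \<open>z $ 1 = 0\<close> but none with \<open>z $ 2 = 0\<close>. Integrability gives the
  other inequality.\<close>

lemma monomial_exponents_hartogs_triangle:
  assumes "1 \<le> p"
  shows "monomial_exponents p (hartogs_triangle \<gamma>) =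
    {\<alpha>. \<alpha> $ 1 \<ge> 0 \<and> \<gamma> * of_int (\<alpha> $ 1) + of_int (\<alpha> $ 2) > - (2 * (1 + \<gamma>) / p)}"
proof -
  have "holomorphic_cn (laurent_monomial \<alpha>) (hartogs_triangle \<gamma>) \<longleftrightarrow> \<alpha> $ 1 \<ge> 0" for \<alpha>
  proof
    assume "\<alpha> $ 1 \<ge> 0"
    moreover have "z $ 2 \<noteq> 0" if "z \<in> hartogs_triangle \<gamma>" for z
      using that by (auto simp: hartogs_triangle_def)
    ultimately show "holomorphic_cn (laurent_monomial \<alpha>) (hartogs_triangle \<gamma>)"
      by (intro holomorphic_laurent_monomial) (metis exhaust_2 not_less)
  next
    assume "holomorphic_cn (laurent_monomial \<alpha>) (hartogs_triangle \<gamma>)"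
    moreover have "vector [0, 1/2] \<in> hartogs_triangle \<gamma>"
      by (simp add: hartogs_triangle_def)
    ultimately show "\<alpha> $ 1 \<ge> 0"
      using not_holomorphic_laurent_monomial[of \<alpha> "vector [0, 1/2]"] by force
  qed
  then show ?thesis
    using assms nn_integral_laurent_monomial_hartogs_triangle
    by (auto simp: monomial_exponents_def bergman_space_def)
qed

section \<open>Threshold exponents\<close>

text \<open>After clearing the denominator \<open>b\<close>, membership compares an integer with
  \<open>K / p\<close>. If \<open>K / p\<close> is not an integer, small changes of \<open>p\<close>
  cross no integer, so thresholds have the form \<open>K / m\<close>; \<open>p\<close> being at
  least 1 bounds \<open>m\<close> by \<open>K\<close>.\<close>

lemma Threshold_rational:
  fixes T \<gamma> :: real and \<Omega> :: "(complex ^ 2) set"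
  assumes S: "\<And>p. 1 \<le> p \<Longrightarrow> monomial_exponents p \<Omega> =
      {\<alpha>. \<alpha> $ 1 \<ge> 0 \<and> \<gamma> * of_int (\<alpha> $ 1) + of_int (\<alpha> $ 2) > - (T / p)}"
    and "0 < T" "\<gamma> \<in> \<rat>"
  shows "finite (Threshold \<Omega>)"
proof -
  obtain a b :: int where ab: "\<gamma> = of_int a / of_int b" "0 < b"
    using \<open>\<gamma> \<in> \<rat>\<close> by (meson Rats_cases')
  define K where "K = of_int b * T"
  have "0 < K"
    using ab \<open>0 < T\<close> by (simp add: K_def)
  have S': "monomial_exponents p \<Omega> =
      {\<alpha>. \<alpha> $ 1 \<ge> 0 \<and> of_int (- (a * \<alpha> $ 1 + b * \<alpha> $ 2)) < K / p}" if "1 \<le> p" for p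
  proof -
    have "\<gamma> * of_int m + of_int n > - (T / p) \<longleftrightarrow> of_int (- (a * m + b * n)) < K / p" for m n
    proof -
      have "\<gamma> * of_int m + of_int n > - (T / p) \<longleftrightarrow>
          of_int b * (- (\<gamma> * of_int m + of_int n)) < of_int b * (T / p)"
        using ab(2) by (subst mult_less_cancel_left_pos) auto
      also have "of_int b * (- (\<gamma> * of_int m + of_int n)) = of_int (- (a * m + b * n))"
        using ab by (simp add: field_simps)
      finally show ?thesis
        by (simp add: K_def)
    qed
    then show ?thesis
      by (simp only: S[OF that])
  qed
  have "p \<in> (\<lambda>m. K / of_int m) ` {1..\<lfloor>K\<rfloor>}" if "p \<in> Threshold \<Omega>" for p
  proof -
    have p: "threshold_exponent \<Omega> p" "1 \<le> p"
      using that by (auto simp: Threshold_def threshold_exponent_def)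
    have "K / p \<in> \<int>"
    proof (rule ccontr)
      assume "K / p \<notin> \<int>"
      then have fl: "of_int \<lfloor>K / p\<rfloor> < K / p" "K / p < of_int \<lfloor>K / p\<rfloor> + 1"
        by (metis Ints_of_int floor_correct order_le_less) linarith
      have lim: "((\<lambda>q. K / q) \<longlongrightarrow> K / p) (nhds p)"
        using p by (intro tendsto_intros tendsto_ident_at) (auto simp: filterlim_ident)
      \<comment> \<open>Besides the equal floor, \<open>K / q\<close> must stay off the integers, so
        that the strict inequality \<open>of_int n < K / q\<close> depends on the floor
        alone.\<close>
      have "\<forall>\<^sub>F q in nhds p. \<lfloor>K / q\<rfloor> = \<lfloor>K / p\<rfloor> \<and> K / q \<noteq> of_int \<lfloor>K / q\<rfloor>"
        using order_tendstoD[OF lim] fl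
        by (smt (verit, best) eventually_elim2 floor_unique)
      then obtain \<epsilon> where "\<epsilon> > 0" and
        \<epsilon>: "\<And>q. dist q p < \<epsilon> \<Longrightarrow> \<lfloor>K / q\<rfloor> = \<lfloor>K / p\<rfloor> \<and> K / q \<noteq> of_int \<lfloor>K / q\<rfloor>"
        unfolding eventually_nhds_metric by blast
      obtain q where q: "q \<in> {p - \<epsilon><..<p + \<epsilon>}" "1 \<le> q" "monomial_exponents q \<Omega> \<noteq> monomial_exponents p \<Omega>"
        using p \<open>\<epsilon> > 0\<close> unfolding threshold_exponent_def by blast
      have "of_int n < K / q \<longleftrightarrow> of_int n < K / p" for n
      proof -
        have "of_int n < x \<longleftrightarrow> n \<le> \<lfloor>x\<rfloor>" if "x \<noteq> of_int \<lfloor>x\<rfloor>" for x :: real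
          using that by (auto simp: le_floor_iff order_less_le)
        moreover have "dist q p < \<epsilon>"
          using q by (auto simp: dist_real_def)
        ultimately show ?thesis
          using \<epsilon>[of q] \<epsilon>[of p] \<open>\<epsilon> > 0\<close> by (metis dist_self)
      qed
      then show False
        using q(3) by (simp only: S'[OF q(2)] S'[OF p(2)] simp_thms)
    qed
    then obtain m where m: "K / p = of_int m"
      by (rule Ints_cases)
    moreover have "0 < K / p" "K / p \<le> K"
      using \<open>0 < K\<close> p by (simp_all add: field_simps)
    ultimately have "m \<in> {1..\<lfloor>K\<rfloor>}" "p = K / of_int m"
      using p \<open>0 < K\<close> by (auto simp: le_floor_iff field_simps)
    then show ?thesis
      by blast
  qed
  then show ?thesis
    by (meson finite_atLeastAtMost_int finite_imageI finite_subset subsetI)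
qed

text \<open>Raising \<open>p\<close> to \<open>q\<close> raises the bound \<open>- (T / p)\<close>.
  By density of the fractional parts of multiples of an irrational number, some exponent with
  positive first entry has its value strictly between the two bounds and is lost.\<close>

lemma Threshold_irrational:
  fixes T \<gamma> :: real and \<Omega> :: "(complex ^ 2) set"
  assumes S: "\<And>p. 1 \<le> p \<Longrightarrow> monomial_exponents p \<Omega> =
      {\<alpha>. \<alpha> $ 1 \<ge> 0 \<and> \<gamma> * of_int (\<alpha> $ 1) + of_int (\<alpha> $ 2) > - (T / p)}"
    and "0 < T" "\<gamma> \<notin> \<rat>"
  shows "Threshold \<Omega> = {1..}"
proof -
  have "\<exists>q. q \<in> {p - \<epsilon><..<p + \<epsilon>} \<and> 1 \<le> q \<and> monomial_exponents q \<Omega> \<noteq> monomial_exponents p \<Omega>"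
    if "1 \<le> p" "0 < \<epsilon>" for p \<epsilon>
  proof -
    \<comment> \<open>Moving to the right keeps \<open>q\<close> at least 1 even when
      \<open>p = 1\<close>.\<close>
    define q where "q = p + \<epsilon> / 2"
    have "p < q" "1 \<le> q"
      using that by (auto simp: q_def)
    then have lt: "- (T / p) < - (T / q)"
      using \<open>0 < T\<close> that by (simp add: divide_strict_left_mono)
    define d where "d = - (T / q) - - (T / p)"
    have "0 < d / 2" using lt by (simp add: d_def)
    \<comment> \<open>The target is the midpoint of the gap and the tolerance is half its length
      \<open>d\<close>, so the value found lies inside the gap.\<close>
    from sequence_of_fractional_parts_is_dense[OF \<open>\<gamma> \<notin> \<rat>\<close> this, of "- (T / p) + d / 2"]
    obtain h k where hk: "0 < k" "\<bar>of_int k * \<gamma> - of_int h - (- (T / p) + d / 2)\<bar> < d / 2"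
      by blast
    define \<alpha> :: "int ^ 2" where "\<alpha> = vector [k, - h]"
    have "- (T / p) < \<gamma> * of_int k - of_int h" "\<gamma> * of_int k - of_int h < - (T / q)"
      using hk(2) unfolding abs_less_iff d_def mult.commute[of \<gamma>] by argo+
    then have "\<alpha> \<in> monomial_exponents p \<Omega>" "\<alpha> \<notin> monomial_exponents q \<Omega>"
      unfolding S[OF \<open>1 \<le> p\<close>] S[OF \<open>1 \<le> q\<close>] using hk(1) by (simp_all add: \<alpha>_def)
    then show ?thesis
      using that \<open>1 \<le> q\<close> by (intro exI[of _ q]) (auto simp: q_def)
  qed
  then show ?thesis
    by (auto simp: Threshold_def threshold_exponent_def)
qed

theorem proposition4p8:
  fixes \<gamma> :: real
  assumes "\<gamma> \<ge> 1"
  shows "(\<forall>p::real. 1 \<le> p \<longrightarrow>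
            monomial_exponents p (hartogs_triangle \<gamma>) =
              {\<alpha>. \<alpha> $ 1 \<ge> 0 \<and>
                   \<gamma> * real_of_int (\<alpha> $ 1) + real_of_int (\<alpha> $ 2) > - (2 / p) - 2 * \<gamma> / p}) \<and>
         (\<gamma> \<in> \<rat> \<longrightarrow> finite (Threshold (hartogs_triangle \<gamma>))) \<and>
         (\<gamma> \<notin> \<rat> \<longrightarrow> Threshold (hartogs_triangle \<gamma>) = {1..})"
proof -
  have "- (2 * (1 + \<gamma>) / p) = - (2 / p) - 2 * \<gamma> / p" for p
    by (simp add: add_divide_distrib distrib_left)
  \<comment> \<open>The first form, with the bound as one quotient \<open>T / p\<close>, feeds the
    threshold lemmas; the second has the bound split into two fractions as in the claim.\<close>
  note exponents = monomial_exponents_hartogs_triangle[of _ \<gamma>]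
    monomial_exponents_hartogs_triangle[of _ \<gamma>, unfolded this]
  have "0 < 2 * (1 + \<gamma>)"
    using assms by simp
  then show ?thesis
    using Threshold_rational[OF exponents(1)] Threshold_irrational[OF exponents(1)] exponents(2)
    by (intro conjI allI impI)
qed

end
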